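(* Let $E$ be a Polish space and let $d$ be any metric on $E$ which generates the given Polish topology. Let $q>r\ge1$, and let $\mu\in\mathcal{P}(E)$ satisfy $\int_E d^q(x,x_0)\,\mu(dx)<\infty$ for some (equivalently, for any) $x_0\in E$. Then, for each $a>0$, $$\limsup_{n\to\infty}\,n^{\frac{q}{r}-1}\mu^n\big(\mathcal{W}_r(L_n,\mu)\ge a\big)<\infty.$$ In particular (the case $r=1$), $\limsup_{n\to\infty}n^{q-1}\mu^n(\mathcal{W}_1(L_n,\mu)\ge a)<\infty$.
   Context: $\mathcal{P}(E)$ is the set of Borel probability measures on $E$. For $r\ge1$ and $\mu,\nu\in\mathcal{P}(E)$ the $r$-Wasserstein distance is defined by $\mathcal{W}_r^r(\mu,\nu)=\inf_{\pi\in\Pi(\mu,\nu)}\int_{E\times E}d^r(x,y)\,\pi(dx,dy)$, where $\Pi(\mu,\nu)$ is the set of probability measures on $E\times E$ with first marginal $\mu$ and second marginal $\nu$. $\mu^n$ is the $n$-fold product measure on $E^n$, and $L_n:E^n\to\mathcal{P}(E)$ is $L_n(x_1,\dots,x_n)=\frac1n\sum_{i=1}^n\delta_{x_i}$. *)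

theory Defs
  imports "HOL-Probability.Probability"
begin

definition couplings ::
    "'a::topological_space measure \<Rightarrow> 'a measure \<Rightarrow> ('a \<times> 'a) measure set" where
  "couplings \<mu> \<nu> =
     {\<pi>. prob_space \<pi> \<and> sets \<pi> = sets (borel \<Otimes>\<^sub>M borel) \<and>
          distr \<pi> borel fst = \<mu> \<and> distr \<pi> borel snd = \<nu>}"

text \<open>The root is taken with value infinity at infinity, so the distance is defined for all
  probability measures, without any moment condition. The metric is an explicit argument
  and unrelated to the \<open>dist\<close> of the type class.\<close>

definition ennreal_root :: "real \<Rightarrow> ennreal \<Rightarrow> ennreal" where
  "ennreal_root r t = (if t = \<infinity> then \<infinity> else ennreal (enn2real t powr (1 / r)))"

definition wasserstein ::
    "real \<Rightarrow> ('a::topological_space \<Rightarrow> 'a \<Rightarrow> real) \<Rightarrow> 'a measure \<Rightarrow> 'a measure \<Rightarrow> ennreal" where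
  "wasserstein r d \<mu> \<nu> =
     ennreal_root r (INF \<pi> \<in> couplings \<mu> \<nu>. \<integral>\<^sup>+ (x, y). ennreal (d x y powr r) \<partial>\<pi>)"

text \<open>Sample points are indexed by \<open>0, \<dots>, n - 1\<close>; the definition is meaningful for \<open>n > 0\<close>.\<close>

definition empirical_measure :: "nat \<Rightarrow> (nat \<Rightarrow> 'a::topological_space) \<Rightarrow> 'a measure" where
  "empirical_measure n x =
     measure_of UNIV (sets borel) (\<lambda>A. (\<Sum>i<n. emeasure (return borel (x i)) A) / of_nat n)"

lemma sets_empirical_measure [simp, measurable_cong]: "sets (empirical_measure n x) = sets borel"
  unfolding empirical_measure_def
  by (metis sets.sets_measure_of_eq space_borel)

lemma emeasure_empirical_measure:
  assumes "A \<in> sets borel"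
  shows "emeasure (empirical_measure n x) A = (\<Sum>i<n. emeasure (return borel (x i)) A) / of_nat n"
proof (rule emeasure_measure_of[OF empirical_measure_def])
  show "positive (sets (empirical_measure n x))
          (\<lambda>A. (\<Sum>i<n. emeasure (return borel (x i)) A) / of_nat n)"
    by (simp add: positive_def)
  show "countably_additive (sets (empirical_measure n x))
          (\<lambda>A. (\<Sum>i<n. emeasure (return borel (x i)) A) / of_nat n)"
  proof (rule countably_additiveI)
    fix B :: "nat \<Rightarrow> 'a set"
    assume B: "range B \<subseteq> sets (empirical_measure n x)" "disjoint_family B"
    have "(\<Sum>j. (\<Sum>i<n. emeasure (return borel (x i)) (B j)) / of_nat n)
        = (\<Sum>j. (\<Sum>i<n. emeasure (return borel (x i)) (B j))) / of_nat n"
      by (simp add: divide_ennreal_def)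
    also have "\<dots> = (\<Sum>i<n. (\<Sum>j. emeasure (return borel (x i)) (B j))) / of_nat n"
      by (subst suminf_sum) auto
    also have "\<dots> = (\<Sum>i<n. emeasure (return borel (x i)) (\<Union>j. B j)) / of_nat n"
      using B by (subst suminf_emeasure) auto
    finally show "(\<Sum>j. (\<Sum>i<n. emeasure (return borel (x i)) (B j)) / of_nat n)
        = (\<Sum>i<n. emeasure (return borel (x i)) (\<Union>j. B j)) / of_nat n" .
  qed
qed (use assms in auto)

lemma prob_space_empirical_measure:
  assumes "n > 0"
  shows "prob_space (empirical_measure n x)"
proof
  have sp: "space (empirical_measure n x) = UNIV"
    using sets_eq_imp_space_eq[OF sets_empirical_measure, of n x] by simp
  show "emeasure (empirical_measure n x) (space (empirical_measure n x)) = 1"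
    unfolding sp using assms by (simp add: emeasure_empirical_measure ennreal_divide_self of_nat_less_top)
qed

text \<open>Finiteness of the moment of order \<open>q\<close> does not depend on the base point.\<close>

lemma finite_moment_base_point:
  fixes d :: "'a::second_countable_topology \<Rightarrow> 'a \<Rightarrow> real"
  assumes "Metric_space UNIV d" "Metric_space.mtopology UNIV d = euclidean"
    and "prob_space \<mu>" "sets \<mu> = sets borel" "q \<ge> 1"
    and fin: "(\<integral>\<^sup>+ x. ennreal (d x x0 powr q) \<partial>\<mu>) < \<infinity>"
  shows "(\<integral>\<^sup>+ x. ennreal (d x x1 powr q) \<partial>\<mu>) < \<infinity>"
proof -
  interpret Metric_space UNIV d by fact
  interpret prob_space \<mu> by fact
  have [measurable_cong]: "sets \<mu> = sets borel" by fact
  have "(\<lambda>x. d x x0) = d x0"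
    by (intro ext commute)
  hence "continuous_map mtopology euclidean (\<lambda>x. d x x0)"
    using continuous_on_mdist[of x0 Self] by (simp add: mtopology_of_def)
  hence "continuous_on UNIV (\<lambda>x. d x x0)"
    using assms(2) by simp
  hence m[measurable]: "(\<lambda>x. d x x0) \<in> borel_measurable borel"
    by (rule borel_measurable_continuous_onI)
  have le: "d x x1 powr q \<le> 2 powr q * d x x0 powr q + 2 powr q * d x0 x1 powr q" for x
  proof -
    have "d x x1 \<le> 2 * max (d x x0) (d x0 x1)"
      using triangle[of x x0 x1] by auto
    hence "d x x1 powr q \<le> (2 * max (d x x0) (d x0 x1)) powr q"
      using assms(5) by (intro powr_mono2) auto
    also have "\<dots> = 2 powr q * max (d x x0) (d x0 x1) powr q"
      by (simp add: powr_mult)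
    also have "\<dots> \<le> 2 powr q * (d x x0 powr q + d x0 x1 powr q)"
      by (intro mult_left_mono) (auto simp: max_def)
    finally show ?thesis by (simp add: algebra_simps)
  qed
  have "(\<integral>\<^sup>+ x. ennreal (d x x1 powr q) \<partial>\<mu>)
      \<le> (\<integral>\<^sup>+ x. ennreal (2 powr q) * ennreal (d x x0 powr q)
                + ennreal (2 powr q * d x0 x1 powr q) \<partial>\<mu>)"
    using le by (intro nn_integral_mono) (simp flip: ennreal_mult ennreal_plus)
  also have "\<dots> = ennreal (2 powr q) * (\<integral>\<^sup>+ x. ennreal (d x x0 powr q) \<partial>\<mu>)
                + ennreal (2 powr q * d x0 x1 powr q)"
    by (simp add: nn_integral_add nn_integral_cmult emeasure_space_1)
  also have "\<dots> < \<infinity>"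
    using fin by (simp add: ennreal_mult_less_top)
  finally show ?thesis .
qed

end

theory Submission
  imports Defs
begin

text \<open>
  The distance between the empirical measure and \<open>\<mu>\<close> is controlled, deterministically, by finitely
  many sample means, and each sample mean has a tail of order \<open>n powr (1 - q / r)\<close>.

  The deterministic part cuts the space into countably many cells of small diameter, of which the
  first \<open>k\<close> are kept and the rest is a remainder whose share of the \<open>r\<close>-th moment under \<open>\<mu>\<close> is
  small. A coupling matches as much mass as possible inside each kept cell and transports the
  excess independently (\<open>coupling_cost_le_partition\<close>). Matched mass travels at most a cell
  diameter. Excess mass is present only in the remainder, where it costs at most a multiple of the
  \<open>r\<close>-th moment,
  and in cells whose empirical frequency differs from their probability; those cells lie in a
  bounded set. So the distance can exceed \<open>a\<close> only if the sample mean of \<open>d(x, x\<^sub>0) powr r\<close>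
  restricted to the remainder, or the frequency of some kept cell or of its complement, exceeds its
  expectation by a fixed amount.

  The probabilistic part (\<open>emeasure_PiM_sum_ge_le\<close>) concerns a nonnegative variable with finite
  moment of order \<open>p > 1\<close>. One summand larger than \<open>c n\<close> occurs with probability
  \<open>O(n powr (1 - p))\<close> by Markov's inequality. For the variables truncated at that level the
  exponential Chebyshev inequality with parameter \<open>\<theta> ln n / n\<close> yields \<open>O(n powr (- \<theta> t))\<close>, and \<open>\<theta>\<close>
  can be chosen at will when \<open>c\<close> is small enough. The variable \<open>d(x, x\<^sub>0) powr r\<close> has a moment of
  order \<open>p = q / r\<close>, and indicators have all moments. Upper tails suffice
  for the frequencies too: a cell that is visited too rarely has a complement that is visited too often.
\<close>

section \<open>Upper tails of sample means of nonnegative variables\<close>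

text \<open>The second order remainder of the exponential, weakened to an exponent at most 2 because
  second moments may be infinite.\<close>

lemma exp_le_remainder_powr:
  fixes u s :: real
  assumes "0 \<le> u" "s \<le> 2" "0 \<le> s"
  shows "exp u \<le> 1 + u + u powr s * exp u"
proof (cases "u \<le> 1")
  case True
  have "u ^ 2 \<le> u powr s"
  proof (cases "u = 0")
    case False
    then have "u powr 2 \<le> u powr s"
      using assms True by (intro powr_mono') auto
    with False show ?thesis using assms by (simp add: powr_numeral)
  qed simp
  also have "\<dots> \<le> u powr s * exp u"
    using assms by (intro mult_le_cancel_left1[THEN iffD2]) auto
  finally show ?thesis
    using exp_bound[OF assms(1) True] by simp
next
  case False
  then have "1 * exp u \<le> u powr s * exp u"
    using assms by (intro mult_right_mono ge_one_powr_ge_zero) auto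
  with assms show ?thesis by linarith
qed

lemma (in prob_space) emeasure_PiM_component_gt:
  fixes f :: "'a \<Rightarrow> real"
  assumes [measurable]: "f \<in> borel_measurable M"
    and nonneg: "\<And>x. 0 \<le> f x" and p: "0 < p" and v: "0 < v"
    and int: "integrable M (\<lambda>x. f x powr p)" and i: "i < n"
  shows "emeasure (Pi\<^sub>M {..<n} (\<lambda>_. M)) {x \<in> space (Pi\<^sub>M {..<n} (\<lambda>_. M)). v < f (x i)}
           \<le> ennreal (v powr (- p) * (\<integral>x. f x powr p \<partial>M))"
proof -
  have "emeasure (Pi\<^sub>M {..<n} (\<lambda>_. M)) {x \<in> space (Pi\<^sub>M {..<n} (\<lambda>_. M)). v < f (x i)}
      = emeasure (distr (Pi\<^sub>M {..<n} (\<lambda>_. M)) M (\<lambda>x. x i)) {y \<in> space M. v < f y}"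
    using i by (subst emeasure_distr)
      (auto intro!: arg_cong2[where f = emeasure] simp: space_PiM PiE_def Pi_def)
  also have "\<dots> = emeasure M {y \<in> space M. v < f y}"
    using i by (subst distr_PiM_component) (auto intro: prob_space_axioms)
  also have "\<dots> = (\<integral>\<^sup>+ y. indicator {y \<in> space M. v < f y} y \<partial>M)"
    by simp
  also have "\<dots> \<le> (\<integral>\<^sup>+ y. ennreal (v powr (- p) * f y powr p) \<partial>M)"
  proof (intro nn_integral_mono)
    fix y
    have "1 \<le> v powr (- p) * f y powr p" if "v < f y"
      using that v p powr_mono2[of p v "f y"] by (simp add: powr_minus field_simps)
    then show "indicator {y \<in> space M. v < f y} y \<le> ennreal (v powr (- p) * f y powr p)"
      by (auto simp: indicator_def ennreal_1[symmetric] simp del: ennreal_1 intro!: ennreal_leI)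
  qed
  also have "\<dots> = ennreal (v powr (- p) * (\<integral>x. f x powr p \<partial>M))"
    using int by (subst nn_integral_eq_integral) auto
  finally show ?thesis .
qed

text \<open>The exponential Chebyshev inequality: the moment generating function of a sum of independent
  variables factorizes.\<close>

lemma (in prob_space) emeasure_PiM_sum_ge_exp:
  fixes g :: "'a \<Rightarrow> real"
  assumes [measurable]: "g \<in> borel_measurable M"
    and l: "0 \<le> l"
    and mgf: "(\<integral>\<^sup>+ y. ennreal (exp (l * g y)) \<partial>M) \<le> ennreal (exp e)"
  shows "emeasure (Pi\<^sub>M {..<n} (\<lambda>_. M))
           {x \<in> space (Pi\<^sub>M {..<n} (\<lambda>_. M)). b \<le> (\<Sum>i<n. g (x i))}
         \<le> ennreal (exp (real n * e - l * b))"
    (is "emeasure ?P ?B \<le> _")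
proof -
  interpret product_sigma_finite "\<lambda>_::nat. M" ..
  have "emeasure ?P ?B = (\<integral>\<^sup>+ x. indicator ?B x \<partial>?P)"
    by (intro nn_integral_indicator[symmetric]) measurable
  also have "\<dots> \<le> (\<integral>\<^sup>+ x. ennreal (exp (- l * b)) * (\<Prod>i<n. ennreal (exp (l * g (x i)))) \<partial>?P)"
  proof (intro nn_integral_mono)
    fix x
    have "1 \<le> exp (- l * b) * (\<Prod>i<n. exp (l * g (x i)))" if "b \<le> (\<Sum>i<n. g (x i))"
      using mult_left_mono[OF that l]
      by (simp add: exp_sum[symmetric] exp_add[symmetric] sum_distrib_left[symmetric])
    then show "indicator ?B x \<le> ennreal (exp (- l * b)) * (\<Prod>i<n. ennreal (exp (l * g (x i))))"
      by (auto simp: indicator_def prod_ennreal prod_nonneg ennreal_mult[symmetric]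
          ennreal_1[symmetric] simp del: ennreal_1 intro!: ennreal_leI)
  qed
  also have "\<dots> = ennreal (exp (- l * b)) * (\<integral>\<^sup>+ y. ennreal (exp (l * g y)) \<partial>M) ^ n"
    by (subst nn_integral_cmult) (auto simp:
        product_nn_integral_prod[where f = "\<lambda>_ y. ennreal (exp (l * g y))"])
  also have "\<dots> \<le> ennreal (exp (- l * b)) * ennreal (exp e) ^ n"
    by (intro mult_left_mono power_mono mgf) auto
  also have "\<dots> = ennreal (exp (real n * e - l * b))"
    by (simp add: ennreal_power ennreal_mult[symmetric] exp_of_nat_mult[symmetric]
        exp_add[symmetric])
  finally show ?thesis .
qed

text \<open>Below the truncation level \<open>v\<close> the factor \<open>exp (l * f x)\<close> in the Taylor remainder is at most
  \<open>exp (l * v)\<close>, and what is left of the remainder is a multiple of the moment of order \<open>s\<close>.\<close>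

lemma (in prob_space) nn_integral_exp_truncated_le:
  fixes f :: "'a \<Rightarrow> real"
  assumes [measurable]: "f \<in> borel_measurable M" and nonneg: "\<And>x. 0 \<le> f x"
    and s: "0 \<le> s" "s \<le> 2" and l: "0 \<le> l" and v: "0 \<le> v"
    and int: "integrable M f" "integrable M (\<lambda>x. f x powr s)"
  shows "(\<integral>\<^sup>+ x. ennreal (exp (l * (if f x \<le> v then f x else 0))) \<partial>M)
     \<le> ennreal (exp (l * (\<integral>x. f x \<partial>M) + l powr s * exp (l * v) * (\<integral>x. f x powr s \<partial>M)))"
proof -
  let ?L = "l powr s * exp (l * v)"
  have le: "exp (l * (if f x \<le> v then f x else 0)) \<le> 1 + l * f x + ?L * f x powr s" for x
  proof (cases "f x \<le> v")
    case True
    have "exp (l * f x) \<le> 1 + l * f x + (l * f x) powr s * exp (l * f x)"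
      using s l nonneg by (intro exp_le_remainder_powr) auto
    also have "(l * f x) powr s * exp (l * f x) \<le> (l * f x) powr s * exp (l * v)"
      using True l by (intro mult_left_mono) (auto intro: mult_left_mono)
    also have "\<dots> = ?L * f x powr s"
      using l nonneg by (simp add: powr_mult)
    finally show ?thesis using True by simp
  next
    case False
    then show ?thesis using l nonneg by simp
  qed
  have "(\<integral>\<^sup>+ x. ennreal (exp (l * (if f x \<le> v then f x else 0))) \<partial>M)
      \<le> (\<integral>\<^sup>+ x. ennreal (1 + l * f x + ?L * f x powr s) \<partial>M)"
    by (intro nn_integral_mono ennreal_leI le)
  also have "\<dots> = ennreal (\<integral>x. 1 + l * f x + ?L * f x powr s \<partial>M)"
    using int l nonneg by (intro nn_integral_eq_integral) auto
  also have "(\<integral>x. 1 + l * f x + ?L * f x powr s \<partial>M)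
      = 1 + (l * (\<integral>x. f x \<partial>M) + ?L * (\<integral>x. f x powr s \<partial>M))"
    using int by (simp add: prob_space)
  also have "\<dots> \<le> exp (l * (\<integral>x. f x \<partial>M) + ?L * (\<integral>x. f x powr s \<partial>M))"
    by (rule exp_ge_add_one_self)
  finally show ?thesis by (simp add: ennreal_leI)
qed

lemma (in prob_space) integrable_powr_le:
  fixes f :: "'a \<Rightarrow> real"
  assumes [measurable]: "f \<in> borel_measurable M" and nonneg: "\<And>x. 0 \<le> f x"
    and s: "0 \<le> s" "s \<le> p" and int: "integrable M (\<lambda>x. f x powr p)"
  shows "integrable M (\<lambda>x. f x powr s)"
proof (rule Bochner_Integration.integrable_bound)
  show "integrable M (\<lambda>x. 1 + f x powr p)" using int by simp
  show "AE x in M. norm (f x powr s) \<le> norm (1 + f x powr p)"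
  proof (intro AE_I2)
    fix x
    show "norm (f x powr s) \<le> norm (1 + f x powr p)"
    proof (cases "f x \<le> 1")
      case True
      then have "f x powr s \<le> 1" using s nonneg by (intro powr_le1) auto
      then show ?thesis by (simp add: add_increasing2)
    next
      case False
      then have "f x powr s \<le> f x powr p" using s by (intro powr_mono) auto
      then show ?thesis by simp
    qed
  qed
qed simp

text \<open>The polynomial tail bound, of Fuk--Nagaev type. With truncation at \<open>v = c n\<close> and
  \<open>l = \<theta> ln n / n\<close>, the exponential bound has the main term \<open>exp (- n l t) = n powr (- \<theta> t)\<close>,
  which determines \<open>\<theta>\<close>. The error term \<open>n * l powr s * exp (l * v)\<close> equals
  \<open>(\<theta> ln n) powr s * n powr (1 - s + \<theta> c)\<close>; since \<open>s > 1\<close>, it stays bounded once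
  \<open>\<theta> c\<close> is half of \<open>s - 1\<close>.\<close>

lemma (in prob_space) emeasure_PiM_sum_ge_le:
  fixes f :: "'a \<Rightarrow> real"
  assumes meas[measurable]: "f \<in> borel_measurable M" and nonneg: "\<And>x. 0 \<le> f x"
    and p: "1 < p" and t: "0 < t" and int: "integrable M (\<lambda>x. f x powr p)"
  shows "\<exists>C\<ge>0. \<forall>n\<ge>1. emeasure (Pi\<^sub>M {..<n} (\<lambda>_. M))
            {x \<in> space (Pi\<^sub>M {..<n} (\<lambda>_. M)). real n * ((\<integral>x. f x \<partial>M) + t) \<le> (\<Sum>i<n. f (x i))}
          \<le> ennreal (C * real n powr (1 - p))"
proof -
  \<comment> \<open>The exponent of the Taylor remainder, lowered to \<open>p\<close> if second moments may be infinite.\<close>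
  define s where "s = min p 2"
  have s: "1 < s" "s \<le> 2" "s \<le> p" using p by (auto simp: s_def)
  define \<theta> where "\<theta> = (p - 1) / t"
  define c where "c = (s - 1) / (2 * \<theta>)"
  \<comment> \<open>The bound \<open>ln n \<le> n powr \<epsilon> / \<epsilon>\<close> turns \<open>(ln n) powr s\<close> into the other half of \<open>s - 1\<close>.\<close>
  define \<epsilon> where "\<epsilon> = (s - 1) / (2 * s)"
  define K where "K = (\<integral>x. f x powr p \<partial>M)"
  define Q where "Q = (\<integral>x. f x powr s \<partial>M)"
  define m where "m = (\<integral>x. f x \<partial>M)"
  define C where "C = c powr (- p) * K + exp ((\<theta> / \<epsilon>) powr s * Q)"
  have \<theta>: "0 < \<theta>" and c: "0 < c" and \<epsilon>: "0 < \<epsilon>"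
    using p t s by (auto simp: \<theta>_def c_def \<epsilon>_def)
  have K: "0 \<le> K" and Q: "0 \<le> Q" by (simp_all add: K_def Q_def)
  have int_s: "integrable M (\<lambda>x. f x powr s)"
    using s by (intro integrable_powr_le[OF meas nonneg _ _ int]) auto
  have int_1: "integrable M f"
  proof -
    have "integrable M (\<lambda>x. f x powr 1)"
      using p by (intro integrable_powr_le[OF meas nonneg _ _ int]) auto
    then show ?thesis using nonneg by (simp add: powr_one)
  qed
  show ?thesis
  proof (intro exI[of _ C] conjI allI impI)
    show "0 \<le> C" using K by (simp add: C_def)
    fix n :: nat assume n: "1 \<le> n"
    define l where "l = \<theta> * ln n / n"
    have l: "0 \<le> l" using n \<theta> by (simp add: l_def)
    define v where "v = c * real n"
    have v: "0 < v" using c n by (simp add: v_def)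
    let ?P = "Pi\<^sub>M {..<n} (\<lambda>_. M)"
    let ?g = "\<lambda>x. if f x \<le> v then f x else 0"
    let ?G = "{x \<in> space ?P. real n * (m + t) \<le> (\<Sum>i<n. f (x i))}"
    let ?A = "\<lambda>i. {x \<in> space ?P. v < f (x i)}"
    let ?B = "{x \<in> space ?P. real n * (m + t) \<le> (\<Sum>i<n. ?g (x i))}"
    have A_sets: "?A i \<in> sets ?P" if "i < n" for i
    proof -
      have [measurable]: "i \<in> {..<n}" using that by simp
      show ?thesis by measurable
    qed
    have B_sets: "?B \<in> sets ?P" by measurable

    have sub: "?G \<subseteq> (\<Union>i<n. ?A i) \<union> ?B"
    proof
      fix x assume x: "x \<in> ?G"
      show "x \<in> (\<Union>i<n. ?A i) \<union> ?B"
      proof (cases "\<exists>i<n. v < f (x i)")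
        case False
        then have "(\<Sum>i<n. ?g (x i)) = (\<Sum>i<n. f (x i))"
          by (intro sum.cong) auto
        with x show ?thesis by simp
      qed (use x in auto)
    qed

    have "emeasure ?P (\<Union>i<n. ?A i) \<le> (\<Sum>i<n. emeasure ?P (?A i))"
      using A_sets by (intro emeasure_subadditive_finite) auto
    also have "\<dots> \<le> (\<Sum>i<n. ennreal (v powr (- p) * K))"
      unfolding K_def using p v nonneg int
      by (intro sum_mono emeasure_PiM_component_gt) auto
    also have "\<dots> = ennreal (c powr (- p) * K * real n powr (1 - p))"
      using n c K by (simp add: v_def powr_mult powr_diff powr_minus ennreal_of_nat_eq_real_of_nat
          ennreal_mult[symmetric] field_simps)
    finally have A: "emeasure ?P (\<Union>i<n. ?A i) \<le> ennreal (c powr (- p) * K * real n powr (1 - p))" .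

    have exp_lv: "exp (l * v) = real n powr ((s - 1) / 2)"
    proof -
      have "l * v = \<theta> * c * ln n" using n by (simp add: l_def v_def)
      also have "\<theta> * c = (s - 1) / 2" using \<theta> by (simp add: c_def)
      finally show ?thesis using n by (simp add: powr_def)
    qed
    have "(\<theta> * ln n) powr s \<le> (\<theta> * (real n powr \<epsilon> / \<epsilon>)) powr s"
      using s n \<epsilon> \<theta> by (intro powr_mono2 mult_left_mono ln_powr_bound) auto
    also have "\<dots> = (\<theta> / \<epsilon>) powr s * real n powr ((s - 1) / 2)"
    proof -
      have "\<theta> * (real n powr \<epsilon> / \<epsilon>) = (\<theta> / \<epsilon>) * real n powr \<epsilon>" by simp
      also have "\<dots> powr s = (\<theta> / \<epsilon>) powr s * real n powr (\<epsilon> * s)"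
        using \<theta> \<epsilon> by (simp add: powr_mult powr_powr del: times_divide_eq_left)
      also have "\<epsilon> * s = (s - 1) / 2" using s by (simp add: \<epsilon>_def)
      finally show ?thesis .
    qed
    finally have ln_le: "(\<theta> * ln n) powr s \<le> (\<theta> / \<epsilon>) powr s * real n powr ((s - 1) / 2)" .
    have "real n * (l powr s * exp (l * v))
        = (\<theta> * ln n) powr s * (real n powr (1 - s) * real n powr ((s - 1) / 2))"
      unfolding exp_lv using n \<theta> by (simp add: l_def powr_divide powr_diff)
    also have "\<dots> \<le> (\<theta> / \<epsilon>) powr s * real n powr ((s - 1) / 2)
         * (real n powr (1 - s) * real n powr ((s - 1) / 2))"
      by (intro mult_right_mono ln_le) auto
    also have "\<dots> = (\<theta> / \<epsilon>) powr s * real n powr ((s - 1) / 2 + (1 - s) + (s - 1) / 2)"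
      by (simp only: powr_add mult.assoc)
    also have "(s - 1) / 2 + (1 - s) + (s - 1) / 2 = 0" by (simp add: field_simps)
    finally have quad: "real n * (l powr s * exp (l * v)) \<le> (\<theta> / \<epsilon>) powr s"
      using n by simp

    have "emeasure ?P ?B
        \<le> ennreal (exp (real n * (l * m + l powr s * exp (l * v) * Q) - l * (real n * (m + t))))"
      unfolding m_def Q_def using s l v nonneg int_1 int_s
      by (intro emeasure_PiM_sum_ge_exp nn_integral_exp_truncated_le) auto
    also have "real n * (l * m + l powr s * exp (l * v) * Q) - l * (real n * (m + t))
        = real n * (l powr s * exp (l * v)) * Q - real n * l * t"
      by (simp add: algebra_simps)
    also have "\<dots> \<le> (\<theta> / \<epsilon>) powr s * Q - real n * l * t"
      using mult_right_mono[OF quad Q] by simp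
    also have "real n * l * t = (p - 1) * ln n"
      using n t by (simp add: l_def \<theta>_def)
    also have "exp ((\<theta> / \<epsilon>) powr s * Q - (p - 1) * ln n)
        = exp ((\<theta> / \<epsilon>) powr s * Q) * real n powr (1 - p)"
      using n by (simp add: powr_def exp_add[symmetric] algebra_simps)
    finally have B: "emeasure ?P ?B
        \<le> ennreal (exp ((\<theta> / \<epsilon>) powr s * Q) * real n powr (1 - p))"
      by (simp add: ennreal_leI)

    have "emeasure ?P ?G \<le> emeasure ?P ((\<Union>i<n. ?A i) \<union> ?B)"
      using A_sets B_sets by (intro emeasure_mono sub) auto
    also have "\<dots> \<le> emeasure ?P (\<Union>i<n. ?A i) + emeasure ?P ?B"
      using A_sets B_sets by (intro emeasure_subadditive) auto
    also have "\<dots> \<le> ennreal (C * real n powr (1 - p))"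
      using add_mono[OF A B] K by (simp add: C_def ennreal_plus[symmetric] algebra_simps
          del: ennreal_plus)
    finally show "emeasure ?P {x \<in> space ?P. real n * ((\<integral>x. f x \<partial>M) + t) \<le> (\<Sum>i<n. f (x i))}
        \<le> ennreal (C * real n powr (1 - p))" unfolding m_def .
  qed
qed

text \<open>The union bound, in the form in which the deterministic estimate can be applied outside a
  single exceptional event. That event is measurable, so its probability bounds the measure of
  every set of samples inside it.\<close>

lemma (in prob_space) measure_PiM_any_sum_ge_le:
  fixes F :: "('a \<Rightarrow> real) set"
  assumes F: "finite F"
    and meas[measurable]: "\<And>f. f \<in> F \<Longrightarrow> f \<in> borel_measurable M"
    and nonneg: "\<And>f x. f \<in> F \<Longrightarrow> 0 \<le> f x"
    and p: "1 < p" and t: "0 < t"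
    and int: "\<And>f. f \<in> F \<Longrightarrow> integrable M (\<lambda>x. f x powr p)"
  shows "\<exists>C. \<forall>n\<ge>1. \<exists>B \<in> sets (Pi\<^sub>M {..<n} (\<lambda>_. M)).
           measure (Pi\<^sub>M {..<n} (\<lambda>_. M)) B \<le> C * real n powr (1 - p) \<and>
           (\<forall>x \<in> space (Pi\<^sub>M {..<n} (\<lambda>_. M)) - B. \<forall>f\<in>F.
              (\<Sum>i<n. f (x i)) < real n * ((\<integral>y. f y \<partial>M) + t))"
proof -
  let ?P = "\<lambda>n. Pi\<^sub>M {..<n} (\<lambda>_. M)"
  let ?B = "\<lambda>n f. {x \<in> space (?P n). real n * ((\<integral>y. f y \<partial>M) + t) \<le> (\<Sum>i<n. f (x i))}"
  have "\<forall>f\<in>F. \<exists>C\<ge>0. \<forall>n\<ge>1. emeasure (?P n) (?B n f) \<le> ennreal (C * real n powr (1 - p))"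
    using meas nonneg p t int by (intro ballI emeasure_PiM_sum_ge_le) auto
  then obtain C where C: "\<And>f. f \<in> F \<Longrightarrow> 0 \<le> C f"
      "\<And>f n. f \<in> F \<Longrightarrow> 1 \<le> n \<Longrightarrow> emeasure (?P n) (?B n f) \<le> ennreal (C f * real n powr (1 - p))"
    using bchoice[of F "\<lambda>f C. 0 \<le> C \<and> (\<forall>n\<ge>1. emeasure (?P n) (?B n f) \<le> ennreal (C * real n powr (1 - p)))"]
    by blast
  show ?thesis
  proof (intro exI[of _ "\<Sum>f\<in>F. C f"] allI impI)
    fix n :: nat assume n: "1 \<le> n"
    interpret P: prob_space "?P n" by (intro prob_space_PiM prob_space_axioms)
    have sets: "?B n f \<in> sets (?P n)" if "f \<in> F" for f
      using that by measurable
    have "measure (?P n) (\<Union>f\<in>F. ?B n f) \<le> (\<Sum>f\<in>F. measure (?P n) (?B n f))"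
      using F sets by (intro P.finite_measure_subadditive_finite) auto
    also have "\<dots> \<le> (\<Sum>f\<in>F. C f * real n powr (1 - p))"
    proof (intro sum_mono)
      fix f assume f: "f \<in> F"
      show "measure (?P n) (?B n f) \<le> C f * real n powr (1 - p)"
        using C(2)[OF f n] C(1)[OF f] by (simp add: P.emeasure_eq_measure)
    qed
    finally have "measure (?P n) (\<Union>f\<in>F. ?B n f) \<le> (\<Sum>f\<in>F. C f) * real n powr (1 - p)"
      by (simp add: sum_distrib_right)
    then show "\<exists>B \<in> sets (?P n). measure (?P n) B \<le> (\<Sum>f\<in>F. C f) * real n powr (1 - p) \<and>
        (\<forall>x \<in> space (?P n) - B. \<forall>f\<in>F. (\<Sum>i<n. f (x i)) < real n * ((\<integral>y. f y \<partial>M) + t))"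
      using F sets by (intro bexI[of _ "\<Union>f\<in>F. ?B n f"] sets.finite_UN) (auto simp: not_le)
  qed
qed


section \<open>A coupling that matches mass inside the cells of a partition\<close>

text \<open>The cells of the partition are the fibres of a label function \<open>\<tau>\<close>, and \<open>w j\<close> is the mass to be
  matched in cell \<open>j\<close>. If a measure is thinned so that mass \<open>w j\<close> is used up in cell \<open>j\<close>, uniformly
  with respect to the measure, this is the density of what remains. A cell of measure zero is left
  untouched, by division by zero.\<close>

definition residual :: "'a measure \<Rightarrow> ('a \<Rightarrow> nat) \<Rightarrow> (nat \<Rightarrow> real) \<Rightarrow> 'a \<Rightarrow> real" where
  "residual M \<tau> w x = 1 - w (\<tau> x) / measure M (\<tau> -` {\<tau> x})"

text \<open>Both marginals of the coupling satisfy these conditions with the same weights, so that facts about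
  thinning are proved once. The labels from \<open>k\<close> on form the remainder, where nothing is matched.\<close>

locale cell_weights = prob_space M for M :: "'a::topological_space measure" +
  fixes \<tau> :: "'a \<Rightarrow> nat" and w :: "nat \<Rightarrow> real" and k :: nat
  assumes sets_M: "sets M = sets borel"
    and cell_measurable[measurable]: "\<tau> \<in> borel \<rightarrow>\<^sub>M count_space UNIV"
    and w_nonneg: "\<And>j. 0 \<le> w j"
    and w_le: "\<And>j. w j \<le> measure M (\<tau> -` {j})"
    and w_support: "\<And>j. k \<le> j \<Longrightarrow> w j = 0"
begin

declare sets_M[measurable_cong]

lemma space_M: "space M = UNIV"
  using sets_eq_imp_space_eq[OF sets_M] by simp

lemma cell_sets[measurable]: "\<tau> -` {j} \<in> sets borel"
  using measurable_sets[OF cell_measurable, of "{j}"] by simp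

lemma cell_sets_M[simp]: "\<tau> -` {j} \<in> sets M"
  by (simp add: sets_M)

lemma tail_sets[measurable]: "{x. k \<le> \<tau> x} \<in> sets borel"
  using measurable_sets[OF cell_measurable, of "{k..}"] by (simp add: vimage_def)

lemma residual_nonneg: "0 \<le> residual M \<tau> w x"
  using w_le[of "\<tau> x"] w_nonneg[of "\<tau> x"]
  by (cases "measure M (\<tau> -` {\<tau> x}) = 0") (auto simp: residual_def divide_le_eq_1)

lemma residual_le_1: "residual M \<tau> w x \<le> 1"
  using w_nonneg[of "\<tau> x"] by (simp add: residual_def)

lemma residual_measurable[measurable]: "residual M \<tau> w \<in> borel_measurable borel"
proof -
  have "(\<lambda>x. (\<lambda>j. 1 - w j / measure M (\<tau> -` {j})) (\<tau> x)) \<in> borel_measurable borel"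
    by (rule measurable_compose[OF cell_measurable]) simp
  then show ?thesis by (simp add: residual_def[abs_def])
qed

lemma residual_eq_sum:
  "residual M \<tau> w x = 1 - (\<Sum>j<k. w j / measure M (\<tau> -` {j}) * indicator (\<tau> -` {j}) x)"
proof -
  have "(\<Sum>j<k. w j / measure M (\<tau> -` {j}) * indicator (\<tau> -` {j}) x)
      = (\<Sum>j<k. if j = \<tau> x then w j / measure M (\<tau> -` {j}) else 0)"
    by (intro sum.cong) (auto simp: indicator_def)
  also have "\<dots> = w (\<tau> x) / measure M (\<tau> -` {\<tau> x})"
    using w_support[of "\<tau> x"] by (simp add: not_less)
  finally show ?thesis by (simp add: residual_def)
qed

lemma weight_cancel: "w j / measure M (\<tau> -` {j}) * measure M (\<tau> -` {j}) = w j"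
  using w_nonneg[of j] w_le[of j] by (cases "measure M (\<tau> -` {j}) = 0") auto

lemma integral_residual: "(\<integral>x. residual M \<tau> w x \<partial>M) = 1 - (\<Sum>j<k. w j)"
proof -
  let ?f = "\<lambda>j x. w j / measure M (\<tau> -` {j}) * indicator (\<tau> -` {j}) x"
  have int: "integrable M (?f j)" for j
    by (auto simp: emeasure_eq_measure)
  have "(\<integral>x. residual M \<tau> w x \<partial>M) = (\<integral>x. 1 \<partial>M) - (\<integral>x. (\<Sum>j<k. ?f j x) \<partial>M)"
    unfolding residual_eq_sum
    by (rule Bochner_Integration.integral_diff) (intro integrable_const Bochner_Integration.integrable_sum int)+
  also have "(\<integral>x. (\<Sum>j<k. ?f j x) \<partial>M) = (\<Sum>j<k. \<integral>x. ?f j x \<partial>M)"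
    by (rule Bochner_Integration.integral_sum) (rule int)
  also have "\<dots> = (\<Sum>j<k. w j)"
  proof (intro sum.cong refl)
    show "(\<integral>x. ?f j x \<partial>M) = w j" for j
      using weight_cancel[of j] by (simp add: space_M)
  qed
  finally show ?thesis by (simp add: prob_space)
qed

lemma integrable_residual: "integrable M (residual M \<tau> w)"
  by (rule integrable_const_bound[where B = 1]) (auto simp: residual_nonneg residual_le_1)

lemma nn_integral_residual:
  "(\<integral>\<^sup>+ x. ennreal (residual M \<tau> w x) \<partial>M) = ennreal (1 - (\<Sum>j<k. w j))"
  using integrable_residual residual_nonneg
  by (subst nn_integral_eq_integral) (auto simp: integral_residual)

lemma weight_sum_le_1: "(\<Sum>j<k. w j) \<le> 1"
proof -
  have "0 \<le> (\<integral>x. residual M \<tau> w x \<partial>M)"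
    by (intro Bochner_Integration.integral_nonneg residual_nonneg)
  then show ?thesis by (simp add: integral_residual)
qed

lemma residual_AE_zero:
  assumes "(\<Sum>j<k. w j) = 1"
  shows "AE x in M. residual M \<tau> w x = 0"
proof -
  have "(\<integral>\<^sup>+ x. ennreal (residual M \<tau> w x) \<partial>M) = 0"
    by (simp add: nn_integral_residual assms)
  then have "AE x in M. ennreal (residual M \<tau> w x) = 0"
    by (subst (asm) nn_integral_0_iff_AE) auto
  then show ?thesis
    by eventually_elim (metis antisym ennreal_eq_0_iff residual_nonneg)
qed

text \<open>The cost of moving the unmatched mass, if a point costs \<open>b x\<close>: outside the remainder the cost is at
  most \<open>R\<close> per unit, and the unmatched mass of cell \<open>j\<close> is its measure minus \<open>w j\<close>.\<close>

lemma nn_integral_residual_mult_le: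
  fixes b :: "'a \<Rightarrow> ennreal"
  assumes [measurable]: "b \<in> borel_measurable borel" and R: "0 \<le> R"
    and bounded: "\<And>x. \<tau> x < k \<Longrightarrow> b x \<le> ennreal R"
  shows "(\<integral>\<^sup>+ x. b x * ennreal (residual M \<tau> w x) \<partial>M)
     \<le> (\<integral>\<^sup>+ x. b x * indicator {x. k \<le> \<tau> x} x \<partial>M)
       + ennreal (R * (\<Sum>j<k. measure M (\<tau> -` {j}) - w j))"
proof -
  let ?e = "\<lambda>j. 1 - w j / measure M (\<tau> -` {j})"
  have e: "0 \<le> ?e j" for j
    using w_le[of j] w_nonneg[of j]
    by (cases "measure M (\<tau> -` {j}) = 0") (auto simp: divide_le_eq_1)
  have le: "b x * ennreal (residual M \<tau> w x) \<le> b x * indicator {x. k \<le> \<tau> x} x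
      + (\<Sum>j<k. ennreal (R * ?e j) * indicator (\<tau> -` {j}) x)" for x
  proof (cases "\<tau> x < k")
    case True
    have "b x * ennreal (residual M \<tau> w x) \<le> ennreal R * ennreal (residual M \<tau> w x)"
      using bounded[OF True] by (intro mult_right_mono) auto
    also have "\<dots> = ennreal (R * ?e (\<tau> x)) * indicator (\<tau> -` {\<tau> x}) x"
      using R residual_nonneg[of x] by (simp add: ennreal_mult residual_def)
    also have "\<dots> \<le> (\<Sum>j<k. ennreal (R * ?e j) * indicator (\<tau> -` {j}) x)"
      using True by (intro member_le_sum) auto
    finally show ?thesis using True by simp
  next
    case False
    then have "b x * ennreal (residual M \<tau> w x) = b x * indicator {x. k \<le> \<tau> x} x"
      using w_support[of "\<tau> x"] by (simp add: residual_def)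
    then show ?thesis by simp
  qed
  have "(\<integral>\<^sup>+ x. b x * ennreal (residual M \<tau> w x) \<partial>M)
     \<le> (\<integral>\<^sup>+ x. b x * indicator {x. k \<le> \<tau> x} x
      + (\<Sum>j<k. ennreal (R * ?e j) * indicator (\<tau> -` {j}) x) \<partial>M)"
    by (intro nn_integral_mono le)
  also have "\<dots> = (\<integral>\<^sup>+ x. b x * indicator {x. k \<le> \<tau> x} x \<partial>M)
      + (\<Sum>j<k. ennreal (R * ?e j) * emeasure M (\<tau> -` {j}))"
  proof -
    have "(\<integral>\<^sup>+ x. (\<Sum>j<k. ennreal (R * ?e j) * indicator (\<tau> -` {j}) x) \<partial>M)
        = (\<Sum>j<k. \<integral>\<^sup>+ x. ennreal (R * ?e j) * indicator (\<tau> -` {j}) x \<partial>M)"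
      by (rule nn_integral_sum) measurable
    also have "\<dots> = (\<Sum>j<k. ennreal (R * ?e j) * emeasure M (\<tau> -` {j}))"
      by (intro sum.cong refl nn_integral_cmult_indicator) simp
    finally have sum_eq: "(\<integral>\<^sup>+ x. (\<Sum>j<k. ennreal (R * ?e j) * indicator (\<tau> -` {j}) x) \<partial>M)
        = (\<Sum>j<k. ennreal (R * ?e j) * emeasure M (\<tau> -` {j}))" .
    have "(\<lambda>x. b x * indicator {x. k \<le> \<tau> x} x) \<in> borel_measurable M"
      "(\<lambda>x. \<Sum>j<k. ennreal (R * ?e j) * indicator (\<tau> -` {j}) x) \<in> borel_measurable M"
      using tail_sets by measurable
    then show ?thesis
      unfolding sum_eq[symmetric] by (rule nn_integral_add)
  qed
  also have "(\<Sum>j<k. ennreal (R * ?e j) * emeasure M (\<tau> -` {j}))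
      = (\<Sum>j<k. ennreal (R * (measure M (\<tau> -` {j}) - w j)))"
  proof (intro sum.cong refl)
    fix j
    have "ennreal (R * ?e j) * emeasure M (\<tau> -` {j}) = ennreal (R * ?e j * measure M (\<tau> -` {j}))"
      unfolding emeasure_eq_measure
      by (rule ennreal_mult[symmetric]) (intro mult_nonneg_nonneg R e measure_nonneg)+
    also have "R * ?e j * measure M (\<tau> -` {j}) = R * (measure M (\<tau> -` {j}) - w j)"
      using weight_cancel[of j] by (simp only: mult.assoc left_diff_distrib mult_1)
    finally show "ennreal (R * ?e j) * emeasure M (\<tau> -` {j}) = ennreal (R * (measure M (\<tau> -` {j}) - w j))" .
  qed
  also have "\<dots> = ennreal (R * (\<Sum>j<k. measure M (\<tau> -` {j}) - w j))"
    using R w_le by (subst sum_ennreal) (auto simp: sum_distrib_left)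
  finally show ?thesis .
qed

end

text \<open>The density, with respect to the product measure, of the coupling. The first term couples the
  matched masses by a product measure in each cell; the second is the product of the two residual
  measures, each of total mass \<open>s\<close>, divided by \<open>s\<close>.\<close>

definition glued_density ::
    "'a measure \<Rightarrow> 'a measure \<Rightarrow> ('a \<Rightarrow> nat) \<Rightarrow> (nat \<Rightarrow> real) \<Rightarrow> real \<Rightarrow> 'a \<Rightarrow> 'a \<Rightarrow> real" where
  "glued_density \<nu> \<mu> \<tau> w s x y =
     w (\<tau> x) / (measure \<nu> (\<tau> -` {\<tau> x}) * measure \<mu> (\<tau> -` {\<tau> x})) * indicator (\<tau> -` {\<tau> x}) y
     + residual \<nu> \<tau> w x * residual \<mu> \<tau> w y / s"

lemma glued_density_commute: "glued_density \<nu> \<mu> \<tau> w s x y = glued_density \<mu> \<nu> \<tau> w s y x"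
  by (auto simp: glued_density_def indicator_def mult.commute)

text \<open>This is the marginal condition. If everything is matched, \<open>s = 0\<close> and the second term vanishes by
  division by zero; then the residual density is zero almost everywhere, which is why the claim
  holds only almost everywhere.\<close>

lemma glued_density_row_integral:
  fixes \<nu> \<mu> :: "'a::topological_space measure"
  assumes "cell_weights \<nu> \<tau> w k" "cell_weights \<mu> \<tau> w k"
    and s: "s = 1 - (\<Sum>j<k. w j)"
  shows "AE x in \<nu>. (\<integral>\<^sup>+ y. ennreal (glued_density \<nu> \<mu> \<tau> w s x y) \<partial>\<mu>) = 1"
proof -
  interpret \<nu>: cell_weights \<nu> \<tau> w k by fact
  interpret \<mu>: cell_weights \<mu> \<tau> w k by fact
  have s0: "0 \<le> s" using \<mu>.weight_sum_le_1 s by simp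
  have row: "(\<integral>\<^sup>+ y. ennreal (glued_density \<nu> \<mu> \<tau> w s x y) \<partial>\<mu>)
      = ennreal (1 - residual \<nu> \<tau> w x + residual \<nu> \<tau> w x * (s / s))" for x
  proof -
    let ?c = "w (\<tau> x) / (measure \<nu> (\<tau> -` {\<tau> x}) * measure \<mu> (\<tau> -` {\<tau> x}))"
    have int: "integrable \<mu> (\<lambda>y. residual \<nu> \<tau> w x * residual \<mu> \<tau> w y / s)"
      "integrable \<mu> (\<lambda>y. ?c * indicator (\<tau> -` {\<tau> x}) y)"
      using \<mu>.integrable_residual by (auto simp: \<mu>.emeasure_eq_measure)
    have "(\<integral>\<^sup>+ y. ennreal (glued_density \<nu> \<mu> \<tau> w s x y) \<partial>\<mu>)
        = ennreal (\<integral>y. glued_density \<nu> \<mu> \<tau> w s x y \<partial>\<mu>)"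
      unfolding glued_density_def using s0 \<mu>.w_nonneg \<mu>.residual_nonneg \<nu>.residual_nonneg int
      by (intro nn_integral_eq_integral) auto
    also have "(\<integral>y. glued_density \<nu> \<mu> \<tau> w s x y \<partial>\<mu>)
        = ?c * measure \<mu> (\<tau> -` {\<tau> x}) + residual \<nu> \<tau> w x * s / s"
      unfolding glued_density_def using int
      by (subst Bochner_Integration.integral_add)
        (auto simp: \<mu>.integral_residual s \<mu>.space_M simp del: times_divide_eq_left)
    also have "?c * measure \<mu> (\<tau> -` {\<tau> x}) = 1 - residual \<nu> \<tau> w x"
      using \<mu>.weight_cancel[of "\<tau> x"]
      by (cases "measure \<mu> (\<tau> -` {\<tau> x}) = 0") (auto simp: residual_def)
    finally show ?thesis by simp
  qed
  show ?thesis
  proof (cases "s = 0")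
    case True
    then have "AE x in \<nu>. residual \<nu> \<tau> w x = 0"
      using s by (intro \<nu>.residual_AE_zero) simp
    then show ?thesis by eventually_elim (simp add: row)
  next
    case False
    then show ?thesis by (simp add: row)
  qed
qed

lemma glued_coupling:
  fixes \<nu> \<mu> :: "'a::second_countable_topology measure"
  assumes "cell_weights \<nu> \<tau> w k" "cell_weights \<mu> \<tau> w k"
    and s: "s = 1 - (\<Sum>j<k. w j)"
  shows "density (\<nu> \<Otimes>\<^sub>M \<mu>) (\<lambda>(x, y). ennreal (glued_density \<nu> \<mu> \<tau> w s x y)) \<in> couplings \<nu> \<mu>"
    (is "?\<pi> \<in> _")
    and "(\<lambda>(x, y). glued_density \<nu> \<mu> \<tau> w s x y) \<in> borel_measurable (borel \<Otimes>\<^sub>M borel)"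
proof -
  interpret \<nu>: cell_weights \<nu> \<tau> w k by fact
  interpret \<mu>: cell_weights \<mu> \<tau> w k by fact
  interpret pair_prob_space \<nu> \<mu> ..
  have "(\<lambda>x. (\<lambda>j. w j / (measure \<nu> (\<tau> -` {j}) * measure \<mu> (\<tau> -` {j}))) (\<tau> x)) \<in> borel_measurable borel"
    by (rule measurable_compose[OF \<mu>.cell_measurable]) simp
  then have [measurable]:
    "(\<lambda>x. w (\<tau> x) / (measure \<nu> (\<tau> -` {\<tau> x}) * measure \<mu> (\<tau> -` {\<tau> x}))) \<in> borel_measurable borel"
    by simp
  have [measurable]: "(\<lambda>x. real (\<tau> x)) \<in> borel_measurable borel"
    by (rule measurable_compose[OF \<mu>.cell_measurable]) simp
  have "(\<lambda>(x, y). if real (\<tau> y) = real (\<tau> x) then 1 else 0 :: real) \<in> borel_measurable (borel \<Otimes>\<^sub>M borel)"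
    by measurable
  moreover have "(\<lambda>(x, y). if real (\<tau> y) = real (\<tau> x) then 1 else 0 :: real)
      = (\<lambda>(x, y). indicator (\<tau> -` {\<tau> x}) y)"
    by (auto simp: indicator_def fun_eq_iff)
  ultimately have [measurable]:
    "(\<lambda>(x, y). indicator (\<tau> -` {\<tau> x}) y :: real) \<in> borel_measurable (borel \<Otimes>\<^sub>M borel)"
    by simp
  show meas[measurable]:
    "(\<lambda>(x, y). glued_density \<nu> \<mu> \<tau> w s x y) \<in> borel_measurable (borel \<Otimes>\<^sub>M borel)"
    unfolding glued_density_def by measurable
  have rows: "AE x in \<nu>. (\<integral>\<^sup>+ y. ennreal (glued_density \<nu> \<mu> \<tau> w s x y) \<partial>\<mu>) = 1"
    using assms by (rule glued_density_row_integral)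
  have cols: "AE y in \<mu>. (\<integral>\<^sup>+ x. ennreal (glued_density \<nu> \<mu> \<tau> w s x y) \<partial>\<nu>) = 1"
    using glued_density_row_integral[OF assms(2,1) s]
    by (simp add: glued_density_commute[of \<mu> \<nu>])

  have fst: "distr ?\<pi> borel fst = \<nu>"
  proof (rule measure_eqI)
    fix A assume "A \<in> sets (distr ?\<pi> borel fst)"
    then have A[measurable]: "A \<in> sets borel" by simp
    have "emeasure (distr ?\<pi> borel fst) A = (\<integral>\<^sup>+ z. indicator A z \<partial>distr ?\<pi> borel fst)"
      by simp
    also have "\<dots> = (\<integral>\<^sup>+ (x, y). ennreal (glued_density \<nu> \<mu> \<tau> w s x y) * indicator A x \<partial>(\<nu> \<Otimes>\<^sub>M \<mu>))"
      by (subst nn_integral_distr, measurable, subst nn_integral_density) (auto simp: case_prod_beta')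
    also have "\<dots> = (\<integral>\<^sup>+ x. (\<integral>\<^sup>+ y. ennreal (glued_density \<nu> \<mu> \<tau> w s x y) * indicator A x \<partial>\<mu>) \<partial>\<nu>)"
      by (subst \<mu>.nn_integral_fst[symmetric]) auto
    also have "\<dots> = (\<integral>\<^sup>+ x. (\<integral>\<^sup>+ y. ennreal (glued_density \<nu> \<mu> \<tau> w s x y) \<partial>\<mu>) * indicator A x \<partial>\<nu>)"
      by (subst nn_integral_multc) auto
    also have "\<dots> = (\<integral>\<^sup>+ x. indicator A x \<partial>\<nu>)"
      by (rule nn_integral_cong_AE, use rows in eventually_elim) simp
    also have "\<dots> = emeasure \<nu> A" using A by (simp add: \<nu>.sets_M)
    finally show "emeasure (distr ?\<pi> borel fst) A = emeasure \<nu> A" .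
  qed (simp add: \<nu>.sets_M)

  have snd: "distr ?\<pi> borel snd = \<mu>"
  proof (rule measure_eqI)
    fix A assume "A \<in> sets (distr ?\<pi> borel snd)"
    then have A[measurable]: "A \<in> sets borel" by simp
    have "emeasure (distr ?\<pi> borel snd) A = (\<integral>\<^sup>+ z. indicator A z \<partial>distr ?\<pi> borel snd)"
      by simp
    also have "\<dots> = (\<integral>\<^sup>+ (x, y). ennreal (glued_density \<nu> \<mu> \<tau> w s x y) * indicator A y \<partial>(\<nu> \<Otimes>\<^sub>M \<mu>))"
      by (subst nn_integral_distr, measurable, subst nn_integral_density) (auto simp: case_prod_beta')
    also have "\<dots> = (\<integral>\<^sup>+ y. (\<integral>\<^sup>+ x. ennreal (glued_density \<nu> \<mu> \<tau> w s x y) * indicator A y \<partial>\<nu>) \<partial>\<mu>)"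
      by (subst nn_integral_snd[symmetric]) auto
    also have "\<dots> = (\<integral>\<^sup>+ y. (\<integral>\<^sup>+ x. ennreal (glued_density \<nu> \<mu> \<tau> w s x y) \<partial>\<nu>) * indicator A y \<partial>\<mu>)"
      by (subst nn_integral_multc) auto
    also have "\<dots> = (\<integral>\<^sup>+ y. indicator A y \<partial>\<mu>)"
      by (rule nn_integral_cong_AE, use cols in eventually_elim) simp
    also have "\<dots> = emeasure \<mu> A" using A by (simp add: \<mu>.sets_M)
    finally show "emeasure (distr ?\<pi> borel snd) A = emeasure \<mu> A" .
  qed (simp add: \<mu>.sets_M)

  have "prob_space (distr ?\<pi> borel fst)"
    unfolding fst by (rule \<nu>.prob_space_axioms)
  then have "prob_space ?\<pi>"
    by (rule prob_space_distrD[rotated]) measurable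
  moreover have "sets ?\<pi> = sets (borel \<Otimes>\<^sub>M borel)"
    using sets_pair_measure_cong[OF \<nu>.sets_M \<mu>.sets_M] by simp
  ultimately show "?\<pi> \<in> couplings \<nu> \<mu>"
    using fst snd by (simp add: couplings_def)
qed

text \<open>The deterministic estimate. Here \<open>D\<close> bounds the cost inside a kept cell, and \<open>b\<close> splits the cost
  of any other transport into a contribution of each endpoint. Matching the minimum of the two masses
  in each kept cell leaves an excess that is at most the difference of the masses.\<close>

lemma coupling_cost_le_partition:
  fixes \<nu> \<mu> :: "'a::second_countable_topology measure"
    and c :: "'a \<Rightarrow> 'a \<Rightarrow> ennreal" and b :: "'a \<Rightarrow> ennreal" and \<tau> :: "'a \<Rightarrow> nat"
  assumes \<nu>: "prob_space \<nu>" "sets \<nu> = sets borel"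
    and \<mu>: "prob_space \<mu>" "sets \<mu> = sets borel"
    and \<tau>[measurable]: "\<tau> \<in> borel \<rightarrow>\<^sub>M count_space UNIV"
    and c[measurable]: "(\<lambda>(x, y). c x y) \<in> borel_measurable (borel \<Otimes>\<^sub>M borel)"
    and b[measurable]: "b \<in> borel_measurable borel"
    and near: "\<And>x y. \<tau> x = \<tau> y \<Longrightarrow> \<tau> x < k \<Longrightarrow> c x y \<le> D"
    and far: "\<And>x y. c x y \<le> b x + b y"
    and bounded: "\<And>x. \<tau> x < k \<Longrightarrow> b x \<le> ennreal R" and R: "0 \<le> R"
  shows "(INF \<pi> \<in> couplings \<nu> \<mu>. \<integral>\<^sup>+ (x, y). c x y \<partial>\<pi>)
    \<le> D + (\<integral>\<^sup>+ x. b x * indicator {x. k \<le> \<tau> x} x \<partial>\<nu>)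
        + (\<integral>\<^sup>+ x. b x * indicator {x. k \<le> \<tau> x} x \<partial>\<mu>)
        + ennreal (2 * R * (\<Sum>j<k. \<bar>measure \<nu> (\<tau> -` {j}) - measure \<mu> (\<tau> -` {j})\<bar>))"
proof -
  define w where "w j = (if j < k then min (measure \<nu> (\<tau> -` {j})) (measure \<mu> (\<tau> -` {j})) else 0)" for j
  define s where "s = 1 - (\<Sum>j<k. w j)"
  interpret \<nu>: prob_space \<nu> by fact
  interpret \<mu>: prob_space \<mu> by fact
  interpret \<nu>: cell_weights \<nu> \<tau> w k
    using \<nu> by unfold_locales (auto simp: w_def)
  interpret \<mu>: cell_weights \<mu> \<tau> w k
    using \<mu> by unfold_locales (auto simp: w_def)
  interpret pair_prob_space \<nu> \<mu> ..
  let ?\<rho> = "glued_density \<nu> \<mu> \<tau> w s"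
  let ?g = "residual \<nu> \<tau> w" and ?h = "residual \<mu> \<tau> w"
  let ?\<pi> = "density (\<nu> \<Otimes>\<^sub>M \<mu>) (\<lambda>(x, y). ennreal (?\<rho> x y))"
  let ?E = "\<Sum>j<k. \<bar>measure \<nu> (\<tau> -` {j}) - measure \<mu> (\<tau> -` {j})\<bar>"
  have coupling: "?\<pi> \<in> couplings \<nu> \<mu>"
    and [measurable]: "(\<lambda>(x, y). ?\<rho> x y) \<in> borel_measurable (borel \<Otimes>\<^sub>M borel)"
    using glued_coupling[OF \<nu>.cell_weights_axioms \<mu>.cell_weights_axioms s_def] by auto
  have s0: "0 \<le> s" using \<mu>.weight_sum_le_1 by (simp add: s_def)

  have mass: "(\<integral>\<^sup>+ (x, y). ennreal (?\<rho> x y) \<partial>(\<nu> \<Otimes>\<^sub>M \<mu>)) = 1"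
  proof -
    have "prob_space ?\<pi>" using coupling by (simp add: couplings_def)
    then have "emeasure ?\<pi> (space ?\<pi>) = 1" by (rule prob_space.emeasure_space_1)
    then show ?thesis
      by (subst (asm) emeasure_density) (auto cong: nn_integral_cong)
  qed

  have residual_mass: "(\<integral>\<^sup>+ x. ennreal (residual M \<tau> w x / s) \<partial>M) \<le> 1"
    if "cell_weights M \<tau> w k" for M :: "'a measure"
  proof -
    interpret M: cell_weights M \<tau> w k by fact
    have "(\<integral>\<^sup>+ x. ennreal (residual M \<tau> w x / s) \<partial>M) = ennreal (s / s)"
      using M.integrable_residual M.residual_nonneg s0
      by (subst nn_integral_eq_integral) (auto simp: M.integral_residual s_def)
    also have "\<dots> \<le> 1" by (cases "s = 0") auto
    finally show ?thesis .
  qed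

  \<comment> \<open>The matched part of the density lives where the cost is at most \<open>D\<close>; the rest is a product, so
    that each of its two terms separates the variables.\<close>
  have pointwise: "ennreal (?\<rho> x y) * c x y
      \<le> D * ennreal (?\<rho> x y)
        + (b x * ennreal (?g x) * ennreal (?h y / s) + b y * ennreal (?h y) * ennreal (?g x / s))" for x y
  proof -
    let ?a = "w (\<tau> x) / (measure \<nu> (\<tau> -` {\<tau> x}) * measure \<mu> (\<tau> -` {\<tau> x})) * indicator (\<tau> -` {\<tau> x}) y"
    let ?r = "?g x * ?h y / s"
    have a0: "0 \<le> ?a" and r0: "0 \<le> ?r"
      using \<mu>.w_nonneg \<mu>.residual_nonneg \<nu>.residual_nonneg s0 by auto
    have \<rho>: "ennreal (?\<rho> x y) = ennreal ?a + ennreal ?r"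
      unfolding glued_density_def using a0 r0 by (rule ennreal_plus)
    have "ennreal ?a * c x y \<le> ennreal ?a * D"
    proof (cases "\<tau> y = \<tau> x \<and> \<tau> x < k")
      case True
      then show ?thesis using near[of x y] by (intro mult_left_mono) auto
    next
      case False
      then have zero: "?a = 0" by (auto simp: w_def indicator_def)
      show ?thesis unfolding zero by simp
    qed
    also have "\<dots> \<le> D * ennreal (?\<rho> x y)"
      unfolding \<rho> by (subst mult.commute) (intro mult_left_mono, auto)
    finally have 1: "ennreal ?a * c x y \<le> D * ennreal (?\<rho> x y)" .
    have "ennreal ?r * c x y \<le> ennreal ?r * (b x + b y)"
      by (intro mult_left_mono far) simp
    also have "\<dots> = b x * ennreal (?g x) * ennreal (?h y / s) + b y * ennreal (?h y) * ennreal (?g x / s)"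
    proof -
      have 1: "ennreal ?r = ennreal (?g x) * ennreal (?h y / s)"
        using \<mu>.residual_nonneg \<nu>.residual_nonneg s0 by (simp add: ennreal_mult[symmetric])
      have 2: "ennreal ?r = ennreal (?h y) * ennreal (?g x / s)"
        using \<mu>.residual_nonneg \<nu>.residual_nonneg s0 by (simp add: ennreal_mult[symmetric] mult.commute)
      have "ennreal ?r * b x = b x * ennreal (?g x) * ennreal (?h y / s)"
        unfolding 1 by (simp only: ac_simps)
      moreover have "ennreal ?r * b y = b y * ennreal (?h y) * ennreal (?g x / s)"
        unfolding 2 by (simp only: ac_simps)
      ultimately show ?thesis unfolding distrib_left by simp
    qed
    finally show ?thesis
      unfolding \<rho> distrib_right using 1 unfolding \<rho> by (intro add_mono)
  qed

  have cost_fst: "(\<integral>\<^sup>+ (x, y). b x * ennreal (?g x) * ennreal (?h y / s) \<partial>(\<nu> \<Otimes>\<^sub>M \<mu>))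
      \<le> (\<integral>\<^sup>+ x. b x * ennreal (?g x) \<partial>\<nu>)"
  proof -
    have "(\<integral>\<^sup>+ (x, y). b x * ennreal (?g x) * ennreal (?h y / s) \<partial>(\<nu> \<Otimes>\<^sub>M \<mu>))
        = (\<integral>\<^sup>+ x. b x * ennreal (?g x) * (\<integral>\<^sup>+ y. ennreal (?h y / s) \<partial>\<mu>) \<partial>\<nu>)"
      by (subst \<mu>.nn_integral_fst[symmetric]) (auto simp: nn_integral_cmult)
    also have "\<dots> \<le> (\<integral>\<^sup>+ x. b x * ennreal (?g x) * 1 \<partial>\<nu>)"
      by (intro nn_integral_mono mult_left_mono residual_mass \<mu>.cell_weights_axioms) auto
    finally show ?thesis by simp
  qed
  have cost_snd: "(\<integral>\<^sup>+ (x, y). b y * ennreal (?h y) * ennreal (?g x / s) \<partial>(\<nu> \<Otimes>\<^sub>M \<mu>))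
      \<le> (\<integral>\<^sup>+ y. b y * ennreal (?h y) \<partial>\<mu>)"
  proof -
    have "(\<integral>\<^sup>+ (x, y). b y * ennreal (?h y) * ennreal (?g x / s) \<partial>(\<nu> \<Otimes>\<^sub>M \<mu>))
        = (\<integral>\<^sup>+ y. b y * ennreal (?h y) * (\<integral>\<^sup>+ x. ennreal (?g x / s) \<partial>\<nu>) \<partial>\<mu>)"
      by (subst nn_integral_snd[symmetric]) (auto simp: nn_integral_cmult)
    also have "\<dots> \<le> (\<integral>\<^sup>+ y. b y * ennreal (?h y) * 1 \<partial>\<mu>)"
      by (intro nn_integral_mono mult_left_mono residual_mass \<nu>.cell_weights_axioms) auto
    finally show ?thesis by simp
  qed

  have excess: "ennreal (R * (\<Sum>j<k. measure M (\<tau> -` {j}) - w j)) \<le> ennreal (R * ?E)"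
    if "M = \<nu> \<or> M = \<mu>" for M
    using that R by (intro ennreal_leI mult_left_mono sum_mono) (auto simp: w_def min_def)

  have "(INF \<pi> \<in> couplings \<nu> \<mu>. \<integral>\<^sup>+ (x, y). c x y \<partial>\<pi>) \<le> (\<integral>\<^sup>+ (x, y). c x y \<partial>?\<pi>)"
    by (rule INF_lower[OF coupling])
  also have "\<dots> = (\<integral>\<^sup>+ (x, y). ennreal (?\<rho> x y) * c x y \<partial>(\<nu> \<Otimes>\<^sub>M \<mu>))"
    by (subst nn_integral_density) (auto simp: case_prod_beta')
  also have "\<dots> \<le> (\<integral>\<^sup>+ (x, y). D * ennreal (?\<rho> x y)
        + (b x * ennreal (?g x) * ennreal (?h y / s) + b y * ennreal (?h y) * ennreal (?g x / s)) \<partial>(\<nu> \<Otimes>\<^sub>M \<mu>))"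
    using pointwise by (intro nn_integral_mono) auto
  also have "\<dots> = D * (\<integral>\<^sup>+ (x, y). ennreal (?\<rho> x y) \<partial>(\<nu> \<Otimes>\<^sub>M \<mu>))
        + ((\<integral>\<^sup>+ (x, y). b x * ennreal (?g x) * ennreal (?h y / s) \<partial>(\<nu> \<Otimes>\<^sub>M \<mu>))
          + (\<integral>\<^sup>+ (x, y). b y * ennreal (?h y) * ennreal (?g x / s) \<partial>(\<nu> \<Otimes>\<^sub>M \<mu>)))"
    unfolding case_prod_beta' by (simp add: nn_integral_add nn_integral_cmult)
  also have "\<dots> \<le> D + ((\<integral>\<^sup>+ x. b x * ennreal (?g x) \<partial>\<nu>) + (\<integral>\<^sup>+ y. b y * ennreal (?h y) \<partial>\<mu>))"
    unfolding mass using cost_fst cost_snd by (intro add_mono) auto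
  also have "\<dots> \<le> D + (((\<integral>\<^sup>+ x. b x * indicator {x. k \<le> \<tau> x} x \<partial>\<nu>) + ennreal (R * ?E))
        + ((\<integral>\<^sup>+ x. b x * indicator {x. k \<le> \<tau> x} x \<partial>\<mu>) + ennreal (R * ?E)))"
    using \<nu>.nn_integral_residual_mult_le[OF b R bounded] \<mu>.nn_integral_residual_mult_le[OF b R bounded]
      excess[of \<nu>] excess[of \<mu>]
    by (intro add_left_mono add_mono) (auto intro: order_trans add_left_mono)
  also have "\<dots> = D + (\<integral>\<^sup>+ x. b x * indicator {x. k \<le> \<tau> x} x \<partial>\<nu>)
        + (\<integral>\<^sup>+ x. b x * indicator {x. k \<le> \<tau> x} x \<partial>\<mu>) + (ennreal (R * ?E) + ennreal (R * ?E))"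
    by (simp add: ac_simps)
  also have "ennreal (R * ?E) + ennreal (R * ?E) = ennreal (2 * R * ?E)"
    using R by (subst ennreal_plus[symmetric]) (auto intro!: mult_nonneg_nonneg sum_nonneg)
  finally show ?thesis .
qed


section \<open>Integrals with respect to the empirical measure\<close>

lemma empirical_measure_eq_distr:
  assumes "n > 0"
  shows "empirical_measure n x = distr (measure_pmf (pmf_of_set {..<n})) borel x"
proof (rule measure_eqI)
  fix A assume "A \<in> sets (empirical_measure n x)"
  then have A: "A \<in> sets borel" by simp
  have "emeasure (distr (measure_pmf (pmf_of_set {..<n})) borel x) A
      = (\<Sum>i<n. indicator A (x i)) / of_nat n"
    using assms A by (subst nn_integral_indicator[symmetric], simp, subst nn_integral_distr)
      (auto simp: nn_integral_pmf_of_set lessThan_empty_iff ennreal_of_nat_eq_real_of_nat)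
  then show "emeasure (empirical_measure n x) A
      = emeasure (distr (measure_pmf (pmf_of_set {..<n})) borel x) A"
    using A by (simp add: emeasure_empirical_measure)
qed simp

lemma nn_integral_empirical_measure:
  fixes f :: "'a::topological_space \<Rightarrow> real"
  assumes n: "n > 0" and "f \<in> borel_measurable borel" and "\<And>y. 0 \<le> f y"
  shows "(\<integral>\<^sup>+ y. ennreal (f y) \<partial>empirical_measure n x) = ennreal ((\<Sum>i<n. f (x i)) / real n)"
proof -
  have "(\<integral>\<^sup>+ y. ennreal (f y) \<partial>empirical_measure n x) = (\<Sum>i<n. ennreal (f (x i))) / ennreal (real n)"
    using assms unfolding empirical_measure_eq_distr[OF n]
    by (subst nn_integral_distr)
      (auto simp: nn_integral_pmf_of_set lessThan_empty_iff ennreal_of_nat_eq_real_of_nat)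
  also have "(\<Sum>i<n. ennreal (f (x i))) = ennreal (\<Sum>i<n. f (x i))"
    using assms by (intro sum_ennreal) auto
  also have "ennreal (\<Sum>i<n. f (x i)) / ennreal (real n) = ennreal ((\<Sum>i<n. f (x i)) / real n)"
    using assms by (intro divide_ennreal sum_nonneg) auto
  finally show ?thesis .
qed

lemma measure_empirical_measure:
  assumes n: "n > 0" and A: "A \<in> sets borel"
  shows "measure (empirical_measure n x) A = (\<Sum>i<n. indicator A (x i)) / real n"
proof -
  have "emeasure (empirical_measure n x) A = (\<integral>\<^sup>+ y. ennreal (indicator A y) \<partial>empirical_measure n x)"
    using A by (simp add: ennreal_indicator)
  also have "\<dots> = ennreal ((\<Sum>i<n. indicator A (x i)) / real n)"
    using A by (intro nn_integral_empirical_measure n) auto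
  finally show ?thesis
    by (simp add: measure_def sum_nonneg)
qed

section \<open>Small cells, and the tail of the Wasserstein distance\<close>

lemma wasserstein_less:
  assumes r: "0 < r" and a: "0 < a"
    and less: "(INF \<pi> \<in> couplings \<nu> \<mu>. \<integral>\<^sup>+ (x, y). ennreal (d x y powr r) \<partial>\<pi>) < ennreal (a powr r)"
  shows "wasserstein r d \<nu> \<mu> < ennreal a"
proof -
  let ?T = "INF \<pi> \<in> couplings \<nu> \<mu>. \<integral>\<^sup>+ (x, y). ennreal (d x y powr r) \<partial>\<pi>"
  from less have "?T < top" by (rule order.strict_trans) simp
  then obtain t where t: "0 \<le> t" "?T = ennreal t"
    by (cases ?T) auto
  have "t < a powr r" using less t by (simp add: ennreal_less_iff)
  then have "t powr (1 / r) < (a powr r) powr (1 / r)"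
    using r t by (intro powr_less_mono2) auto
  also have "\<dots> = a" using r a by (simp add: powr_powr)
  finally show ?thesis
    using t by (simp add: wasserstein_def ennreal_root_def ennreal_less_iff)
qed

lemma metric_borel_measurable:
  fixes d :: "'a::second_countable_topology \<Rightarrow> 'a \<Rightarrow> real"
  assumes "Metric_space UNIV d" and top: "Metric_space.mtopology UNIV d = euclidean"
  shows "(\<lambda>(x, y). d x y) \<in> borel_measurable (borel \<Otimes>\<^sub>M borel)"
proof -
  interpret Metric_space UNIV d by fact
  have "continuous_map (prod_topology mtopology mtopology) euclidean (\<lambda>p. d (fst p) (snd p))"
    using continuous_map_mdist[where m = Self and f = fst and g = snd and X = "prod_topology mtopology mtopology"]
    by (simp add: mtopology_of_def continuous_map_fst continuous_map_snd)
  then have "continuous_on UNIV (\<lambda>p. d (fst p) (snd p))"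
    by (simp add: top)
  then show ?thesis
    by (simp add: case_prod_beta' borel_prod borel_measurable_continuous_onI)
qed

text \<open>Each point is labelled with the first element of a dense sequence near it. Separability thus
  replaces tightness: the sets \<open>{x. k \<le> \<tau> x}\<close> decrease to the empty set, and each set
  \<open>{x. \<tau> x < k}\<close> is bounded.\<close>

lemma countable_small_cells:
  fixes d :: "'a::second_countable_topology \<Rightarrow> 'a \<Rightarrow> real"
  assumes "Metric_space UNIV d" and top: "Metric_space.mtopology UNIV d = euclidean"
    and \<delta>: "0 < \<delta>"
  obtains \<tau> :: "'a \<Rightarrow> nat" and z :: "nat \<Rightarrow> 'a"
  where "\<tau> \<in> borel \<rightarrow>\<^sub>M count_space UNIV" and "\<And>x. d x (z (\<tau> x)) < \<delta>"
proof -
  interpret Metric_space UNIV d by fact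
  have [measurable]: "(\<lambda>(x, y). d x y) \<in> borel_measurable (borel \<Otimes>\<^sub>M borel)"
    using assms by (intro metric_borel_measurable)
  obtain S :: "'a set" where S: "countable S" "\<And>X. open X \<Longrightarrow> X \<noteq> {} \<Longrightarrow> \<exists>s\<in>S. s \<in> X"
    by (rule countable_dense_setE) blast
  have "S \<noteq> {}" using S(2)[of UNIV] by auto
  define z where "z = from_nat_into S"
  define \<tau> where "\<tau> x = (LEAST j. d x (z j) < \<delta>)" for x
  have "\<exists>j. d x (z j) < \<delta>" for x
  proof -
    have "open (mball x \<delta>)" using openin_mball[of x \<delta>] by (simp add: top)
    moreover have "x \<in> mball x \<delta>" using \<delta> by simp
    ultimately obtain s where "s \<in> S" "d x s < \<delta>"
      using S(2)[of "mball x \<delta>"] by auto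
    then show ?thesis
      using from_nat_into_surj[OF S(1)] unfolding z_def by metis
  qed
  then have "d x (z (\<tau> x)) < \<delta>" for x
    unfolding \<tau>_def by (rule LeastI_ex)
  moreover have "\<tau> \<in> borel \<rightarrow>\<^sub>M count_space UNIV"
    unfolding \<tau>_def[abs_def] by measurable
  ultimately show thesis using that by blast
qed

text \<open>The four terms of the deterministic estimate are kept within \<open>A / 8\<close>, \<open>A / 4\<close>, \<open>A / 8\<close> and \<open>A / 8\<close>,
  where \<open>A = a powr r\<close> is the level that the transport cost must not reach.\<close>

proposition empirical_measure_wasserstein_tail:
  fixes d :: "'a::second_countable_topology \<Rightarrow> 'a \<Rightarrow> real" and \<mu> :: "'a measure"
  assumes metric: "Metric_space UNIV d" and top: "Metric_space.mtopology UNIV d = euclidean"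
    and r: "1 \<le> r" and q: "r < q"
    and \<mu>: "prob_space \<mu>" and sets_\<mu>: "sets \<mu> = sets borel"
    and moment: "(\<integral>\<^sup>+ x. ennreal (d x x0 powr q) \<partial>\<mu>) < \<infinity>"
    and a: "0 < a"
  shows "\<exists>C. \<forall>n\<ge>1. measure (Pi\<^sub>M {..<n} (\<lambda>_. \<mu>))
      {x \<in> space (Pi\<^sub>M {..<n} (\<lambda>_. \<mu>)). wasserstein r d (empirical_measure n x) \<mu> \<ge> ennreal a}
    \<le> C * real n powr (1 - q / r)"
proof -
  interpret Metric_space UNIV d by fact
  interpret prob_space \<mu> by fact
  note sets_\<mu>[measurable_cong]
  have d_measurable[measurable]: "(\<lambda>(x, y). d x y) \<in> borel_measurable (borel \<Otimes>\<^sub>M borel)"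
    using metric top by (rule metric_borel_measurable)
  have space_\<mu>: "space \<mu> = UNIV"
    using sets_eq_imp_space_eq[OF sets_\<mu>] by simp
  define A where "A = a powr r"
  have A: "0 < A" using a by (simp add: A_def)
  define p where "p = q / r"
  have p: "1 < p" using r q by (simp add: p_def)

  \<comment> \<open>Two points of a cell are at distance below \<open>a / 8\<close>, and \<open>(1 / 8) powr r \<le> 1 / 8\<close>.\<close>
  obtain \<tau> :: "'a \<Rightarrow> nat" and z where \<tau>[measurable]: "\<tau> \<in> borel \<rightarrow>\<^sub>M count_space UNIV"
    and z: "\<And>x. d x (z (\<tau> x)) < a / 16"
    using countable_small_cells[OF metric top, of "a / 16"] a by auto
  have cell_sets[measurable]: "\<tau> -` {j} \<in> sets borel" for j
    using measurable_sets[OF \<tau>, of "{j}"] by simp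
  have tail_sets[measurable]: "{x. k \<le> \<tau> x} \<in> sets borel" for k
    using measurable_sets[OF \<tau>, of "{k..}"] by (simp add: vimage_def)

  define b where "b x = 2 powr r * d x x0 powr r" for x
  have b_measurable[measurable]: "b \<in> borel_measurable borel"
    unfolding b_def[abs_def] by measurable
  have b_nonneg: "0 \<le> b x" for x by (simp add: b_def)
  have b_powr: "b x powr p = 2 powr q * d x x0 powr q" for x
    using r by (simp add: b_def p_def powr_mult powr_powr)
  have int_bp: "integrable \<mu> (\<lambda>x. b x powr p)"
    unfolding b_powr using moment
    by (intro integrable_mult_right integrableI_nonneg) auto
  have int_b: "integrable \<mu> b"
  proof -
    have "integrable \<mu> (\<lambda>x. b x powr 1)"
      using p b_nonneg int_bp by (intro integrable_powr_le[OF _ _ _ _ int_bp]) auto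
    then show ?thesis using b_nonneg by simp
  qed

  have near: "d x y powr r \<le> A / 8" if "\<tau> x = \<tau> y" for x y
  proof -
    have "d x y \<le> d x (z (\<tau> x)) + d (z (\<tau> x)) y" by (rule triangle) auto
    also have "\<dots> \<le> a * (1 / 8)"
      using z[of x] z[of y] that by (simp add: commute)
    finally have "d x y powr r \<le> (a * (1 / 8)) powr r"
      using r by (intro powr_mono2) auto
    also have "\<dots> = A * (1 / 8) powr r" using a by (simp add: A_def powr_divide)
    also have "(1 / 8) powr r \<le> (1 / 8 :: real) powr 1"
      using r by (intro powr_mono') auto
    finally show ?thesis using A by simp
  qed
  have far: "d x y powr r \<le> b x + b y" for x y
  proof -
    have "d x y \<le> 2 * max (d x x0) (d y x0)"
      using triangle[of x x0 y] by (auto simp: commute)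
    then have "d x y powr r \<le> (2 * max (d x x0) (d y x0)) powr r"
      using r by (intro powr_mono2) auto
    also have "\<dots> = 2 powr r * max (d x x0) (d y x0) powr r"
      by (simp add: powr_mult)
    also have "\<dots> \<le> 2 powr r * (d x x0 powr r + d y x0 powr r)"
      by (intro mult_left_mono) (auto simp: max_def)
    finally show ?thesis by (simp add: b_def algebra_simps)
  qed

  \<comment> \<open>The number of kept cells is chosen by dominated convergence.\<close>
  have "(\<lambda>k. \<integral>x. b x * indicator {x. k \<le> \<tau> x} x \<partial>\<mu>) \<longlonglongrightarrow> (\<integral>x. 0 \<partial>\<mu>)"
  proof (rule integral_dominated_convergence[where w = b])
    show "AE x in \<mu>. (\<lambda>k. b x * indicator {x. k \<le> \<tau> x} x) \<longlonglongrightarrow> 0"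
    proof (intro AE_I2 tendsto_eventually)
      fix x
      show "\<forall>\<^sub>F k in sequentially. b x * indicator {x. k \<le> \<tau> x} x = 0"
        using eventually_gt_at_top[of "\<tau> x"] by eventually_elim simp
    qed
  qed (use int_b b_nonneg in \<open>auto simp: indicator_def\<close>)
  then have "\<forall>\<^sub>F k in sequentially. (\<integral>x. b x * indicator {x. k \<le> \<tau> x} x \<partial>\<mu>) < A / 8"
    using A by (intro order_tendstoD(2)) auto
  then obtain k where k: "(\<integral>x. b x * indicator {x. k \<le> \<tau> x} x \<partial>\<mu>) < A / 8"
    by (auto simp: eventually_sequentially)
  define f0 where "f0 x = b x * indicator {x. k \<le> \<tau> x} x" for x
  have f0_nonneg: "0 \<le> f0 x" for x by (simp add: f0_def b_nonneg)
  have f0_measurable[measurable]: "f0 \<in> borel_measurable borel"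
    unfolding f0_def[abs_def] by measurable
  have int_f0: "integrable \<mu> f0"
    by (rule Bochner_Integration.integrable_bound[OF int_b])
      (auto simp: f0_def b_nonneg indicator_def)
  have int_f0p: "integrable \<mu> (\<lambda>x. f0 x powr p)"
    by (rule Bochner_Integration.integrable_bound[OF int_bp])
      (auto simp: f0_def b_nonneg indicator_def)
  have tail_mean: "(\<integral>x. f0 x \<partial>\<mu>) < A / 8" using k by (simp add: f0_def[abs_def])

  define R where "R = 2 powr r * (a / 16 + (\<Sum>j<k. d (z j) x0)) powr r"
  have R: "0 \<le> R" by (simp add: R_def)
  have bounded: "b x \<le> R" if "\<tau> x < k" for x
  proof -
    have "d x x0 \<le> d x (z (\<tau> x)) + d (z (\<tau> x)) x0" by (rule triangle) auto
    also have "d (z (\<tau> x)) x0 \<le> (\<Sum>j<k. d (z j) x0)"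
      using that by (intro member_le_sum) auto
    finally have "d x x0 \<le> a / 16 + (\<Sum>j<k. d (z j) x0)"
      using z[of x] by simp
    then show ?thesis
      unfolding b_def R_def using r by (intro mult_left_mono powr_mono2) auto
  qed

  \<comment> \<open>The common tolerance: it must be harmless for the remainder, and \<open>k\<close> deviations of the cell
    frequencies, each weighted with \<open>2 R\<close>, must be harmless together; the summand 1 covers both
    the former and \<open>R = 0\<close>.\<close>
  define t where "t = A / (8 * (2 * R * real k + 1))"
  have t: "0 < t" using A R by (auto simp: t_def intro!: divide_pos_pos add_nonneg_pos)
  have cancel: "A / (8 * X) * X = A / 8" if "0 < X" for X
    using that by simp
  have "t * (2 * R * real k + 1) = A / 8"
    unfolding t_def using R by (intro cancel add_nonneg_pos) auto
  then have t_sum: "2 * R * (real k * t) + t = A / 8"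
    by (simp add: algebra_simps)

  define F where "F = {f0} \<union> (\<lambda>j. indicator (\<tau> -` {j})) ` {..<k} \<union> (\<lambda>j. indicator (- \<tau> -` {j})) ` {..<k}"
  have "\<exists>C. \<forall>n\<ge>1. \<exists>B \<in> sets (Pi\<^sub>M {..<n} (\<lambda>_. \<mu>)).
      measure (Pi\<^sub>M {..<n} (\<lambda>_. \<mu>)) B \<le> C * real n powr (1 - p) \<and>
      (\<forall>x \<in> space (Pi\<^sub>M {..<n} (\<lambda>_. \<mu>)) - B. \<forall>f\<in>F.
        (\<Sum>i<n. f (x i)) < real n * ((\<integral>y. f y \<partial>\<mu>) + t))"
  proof (rule measure_PiM_any_sum_ge_le)
    have powr_indicator: "(indicator S x :: real) powr p = indicator S x" for S and x :: 'a
      using p by (simp add: indicator_def)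
    show "integrable \<mu> (\<lambda>x. f x powr p)" if "f \<in> F" for f
      using that int_f0p by (auto simp: F_def powr_indicator emeasure_eq_measure)
  qed (use p t f0_nonneg in \<open>auto simp: F_def\<close>)
  then obtain C where C: "\<forall>n\<ge>1. \<exists>B \<in> sets (Pi\<^sub>M {..<n} (\<lambda>_. \<mu>)).
      measure (Pi\<^sub>M {..<n} (\<lambda>_. \<mu>)) B \<le> C * real n powr (1 - p) \<and>
      (\<forall>x \<in> space (Pi\<^sub>M {..<n} (\<lambda>_. \<mu>)) - B. \<forall>f\<in>F.
        (\<Sum>i<n. f (x i)) < real n * ((\<integral>y. f y \<partial>\<mu>) + t))" by blast

  show ?thesis
  proof (intro exI[of _ C] allI impI)
    fix n :: nat assume n1: "1 \<le> n"
    then have n: "0 < n" by simp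
    let ?P = "Pi\<^sub>M {..<n} (\<lambda>_. \<mu>)"
    let ?W = "{x \<in> space ?P. wasserstein r d (empirical_measure n x) \<mu> \<ge> ennreal a}"
    interpret P: prob_space ?P by (intro prob_space_PiM prob_space_axioms)
    obtain B where B: "B \<in> sets ?P" "measure ?P B \<le> C * real n powr (1 - p)"
      and good: "\<And>x f. x \<in> space ?P - B \<Longrightarrow> f \<in> F \<Longrightarrow>
        (\<Sum>i<n. f (x i)) < real n * ((\<integral>y. f y \<partial>\<mu>) + t)"
      using C[rule_format, OF n1] by (elim bexE conjE) (rule that, auto)
    have close: "wasserstein r d (empirical_measure n x) \<mu> < ennreal a" if x: "x \<in> space ?P - B" for x
    proof -
      let ?L = "empirical_measure n x"
      interpret L: prob_space ?L by (rule prob_space_empirical_measure[OF n])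
      have space_L: "space ?L = UNIV"
        using sets_eq_imp_space_eq[OF sets_empirical_measure, of n x] by simp
      have mean: "(\<Sum>i<n. f (x i)) / real n < (\<integral>y. f y \<partial>\<mu>) + t" if "f \<in> F" for f
        using good[OF x that] n by (simp add: field_simps)
      have freq: "measure ?L S < measure \<mu> S + t"
        if "S \<in> sets borel" "indicator S \<in> F" for S
        using mean[OF that(2)] that(1) n by (simp add: measure_empirical_measure space_\<mu>)
      have dev: "\<bar>measure ?L (\<tau> -` {j}) - measure \<mu> (\<tau> -` {j})\<bar> \<le> t" if "j < k" for j
      proof -
        have "measure ?L (\<tau> -` {j}) < measure \<mu> (\<tau> -` {j}) + t"
          using that by (intro freq) (auto simp: F_def)
        moreover have "measure ?L (- \<tau> -` {j}) < measure \<mu> (- \<tau> -` {j}) + t"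
          using that by (intro freq) (auto simp: F_def)
        moreover have "measure ?L (- \<tau> -` {j}) = 1 - measure ?L (\<tau> -` {j})"
          using L.prob_compl[of "\<tau> -` {j}"] by (simp add: space_L Compl_eq_Diff_UNIV)
        moreover have "measure \<mu> (- \<tau> -` {j}) = 1 - measure \<mu> (\<tau> -` {j})"
          using prob_compl[of "\<tau> -` {j}"] by (simp add: space_\<mu> sets_\<mu> Compl_eq_Diff_UNIV)
        ultimately show ?thesis by linarith
      qed
      have "(\<Sum>j<k. \<bar>measure ?L (\<tau> -` {j}) - measure \<mu> (\<tau> -` {j})\<bar>) \<le> (\<Sum>j<k. t)"
        using dev by (intro sum_mono) auto
      then have dev_sum: "2 * R * (\<Sum>j<k. \<bar>measure ?L (\<tau> -` {j}) - measure \<mu> (\<tau> -` {j})\<bar>)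
          \<le> 2 * R * (real k * t)"
        using R by (intro mult_left_mono) auto
      have f0_eq: "ennreal (b y) * indicator {y. k \<le> \<tau> y} y = ennreal (f0 y)" for y
        by (simp add: f0_def indicator_def)

      have "(INF \<pi> \<in> couplings ?L \<mu>. \<integral>\<^sup>+ (x, y). ennreal (d x y powr r) \<partial>\<pi>)
        \<le> ennreal (A / 8) + (\<integral>\<^sup>+ y. ennreal (b y) * indicator {y. k \<le> \<tau> y} y \<partial>?L)
          + (\<integral>\<^sup>+ y. ennreal (b y) * indicator {y. k \<le> \<tau> y} y \<partial>\<mu>)
          + ennreal (2 * R * (\<Sum>j<k. \<bar>measure ?L (\<tau> -` {j}) - measure \<mu> (\<tau> -` {j})\<bar>))"
      proof (rule coupling_cost_le_partition[OF L.prob_space_axioms sets_empirical_measure \<mu> sets_\<mu> \<tau>])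
        show "ennreal (d x y powr r) \<le> ennreal (b x) + ennreal (b y)" for x y
          using far[of x y] b_nonneg by (simp flip: ennreal_plus)
      qed (use R near bounded in \<open>auto intro: ennreal_leI\<close>)
      also have "\<dots> = ennreal (A / 8) + ennreal ((\<Sum>i<n. f0 (x i)) / real n)
          + ennreal (\<integral>y. f0 y \<partial>\<mu>)
          + ennreal (2 * R * (\<Sum>j<k. \<bar>measure ?L (\<tau> -` {j}) - measure \<mu> (\<tau> -` {j})\<bar>))"
        unfolding f0_eq using n f0_nonneg int_f0
        by (simp add: nn_integral_empirical_measure nn_integral_eq_integral)
      also have "\<dots> = ennreal (A / 8 + (\<Sum>i<n. f0 (x i)) / real n + (\<integral>y. f0 y \<partial>\<mu>)
          + 2 * R * (\<Sum>j<k. \<bar>measure ?L (\<tau> -` {j}) - measure \<mu> (\<tau> -` {j})\<bar>))"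
        using A R f0_nonneg
        by (simp add: ennreal_plus[symmetric] sum_nonneg integral_nonneg_AE del: ennreal_plus)
      also have "\<dots> < ennreal A"
      proof (rule ennreal_lessI[OF A])
        have "(\<Sum>i<n. f0 (x i)) / real n < (\<integral>y. f0 y \<partial>\<mu>) + t"
          by (rule mean) (simp add: F_def)
        then show "A / 8 + (\<Sum>i<n. f0 (x i)) / real n + (\<integral>y. f0 y \<partial>\<mu>)
          + 2 * R * (\<Sum>j<k. \<bar>measure ?L (\<tau> -` {j}) - measure \<mu> (\<tau> -` {j})\<bar>) < A"
          using tail_mean dev_sum t_sum A by linarith
      qed
      finally show ?thesis
        unfolding A_def using r a by (intro wasserstein_less) auto
    qed
    have "?W \<subseteq> B"
      using close by (force simp: not_le[symmetric])
    then have "measure ?P ?W \<le> measure ?P B"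
      using B by (intro P.finite_measure_mono) auto
    also have "\<dots> \<le> C * real n powr (1 - q / r)"
      using B by (simp add: p_def)
    finally show "measure ?P ?W \<le> C * real n powr (1 - q / r)" .
  qed
qed

lemma limsup_powr_mult_less_infinity:
  assumes "\<And>n. 1 \<le> n \<Longrightarrow> g n \<le> C * real n powr (- s)"
  shows "limsup (\<lambda>n. ereal (real n powr s * g n)) < \<infinity>"
proof -
  have "limsup (\<lambda>n. ereal (real n powr s * g n)) \<le> ereal C"
  proof (rule Limsup_bounded)
    show "\<forall>\<^sub>F n in sequentially. ereal (real n powr s * g n) \<le> ereal C"
      using eventually_ge_at_top[of 1]
    proof eventually_elim
      case (elim n)
      have "real n powr s * g n \<le> real n powr s * (C * real n powr (- s))"
        using assms[OF elim] by (intro mult_left_mono) auto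
      also have "\<dots> = C" using elim by (simp add: powr_minus)
      finally show ?case by simp
    qed
  qed
  then show ?thesis by (rule order.strict_trans1) simp
qed

theorem corollary1p3:
  fixes d :: "'a::polish_space \<Rightarrow> 'a \<Rightarrow> real"
    and \<mu> :: "'a measure"
    and q r :: real
  assumes "Metric_space UNIV d"
    and "Metric_space.mtopology UNIV d = (euclidean :: 'a topology)"
    and "1 \<le> r" and "r < q"
    and "prob_space \<mu>" and "sets \<mu> = sets borel"
    and "\<exists>x0. (\<integral>\<^sup>+ x. ennreal (d x x0 powr q) \<partial>\<mu>) < \<infinity>"
  shows "(\<forall>a>0. limsup (\<lambda>n. ereal (real n powr (q / r - 1) *
             measure (Pi\<^sub>M {..<n} (\<lambda>_. \<mu>))
               {x \<in> space (Pi\<^sub>M {..<n} (\<lambda>_. \<mu>)).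
                  wasserstein r d (empirical_measure n x) \<mu> \<ge> ennreal a})) < \<infinity>) \<and>
         (\<forall>a>0. limsup (\<lambda>n. ereal (real n powr (q - 1) *
             measure (Pi\<^sub>M {..<n} (\<lambda>_. \<mu>))
               {x \<in> space (Pi\<^sub>M {..<n} (\<lambda>_. \<mu>)).
                  wasserstein 1 d (empirical_measure n x) \<mu> \<ge> ennreal a})) < \<infinity>)"
proof -
  obtain x0 where x0: "(\<integral>\<^sup>+ x. ennreal (d x x0 powr q) \<partial>\<mu>) < \<infinity>"
    using assms(7) by blast
  have bounded: "limsup (\<lambda>n. ereal (real n powr (q / s - 1) *
      measure (Pi\<^sub>M {..<n} (\<lambda>_. \<mu>))
        {x \<in> space (Pi\<^sub>M {..<n} (\<lambda>_. \<mu>)).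
           wasserstein s d (empirical_measure n x) \<mu> \<ge> ennreal a})) < \<infinity>"
    if s: "1 \<le> s" "s < q" and a: "0 < a" for s a
  proof -
    obtain C where "\<And>n. 1 \<le> n \<Longrightarrow> measure (Pi\<^sub>M {..<n} (\<lambda>_. \<mu>))
        {x \<in> space (Pi\<^sub>M {..<n} (\<lambda>_. \<mu>)). wasserstein s d (empirical_measure n x) \<mu> \<ge> ennreal a}
      \<le> C * real n powr (1 - q / s)"
      using empirical_measure_wasserstein_tail[OF assms(1,2) s assms(5,6) x0 a] by blast
    then show ?thesis
      by (intro limsup_powr_mult_less_infinity[where C = C]) simp
  qed
  show ?thesis
    using bounded[of r] bounded[of 1] assms(3,4) by simp
qed

end
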